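(* There is no value of $\alpha$ for which the geometric median is $\alpha$-strategyproof, even when restricted to families of other voters' vectors of dimension at least $2$. That is, for every real $\alpha\ge 0$ there exist a dimension $d$, a number $V\ge 1$ of other voters, a family $\vec\theta=(\theta_1,\dots,\theta_V)$ of vectors of $\mathbb{R}^d$ with $\dim\vec\theta\ge 2$, a target vector $t\in\mathbb{R}^d$ and a strategic vote $s\in\mathbb{R}^d$ such that $$\|\mathrm{Gm}(t,\vec\theta)-t\|_2 > (1+\alpha)\,\|\mathrm{Gm}(s,\vec\theta)-t\|_2 .$$
   Context: There are $1+V$ voters. Voters $1,\dots,V$ report vectors $\theta_1,\dots,\theta_V\in\mathbb{R}^d$; write $\vec\theta=(\theta_1,\dots,\theta_V)$. Voter $0$ has a target vector $t\in\mathbb{R}^d$ but may report any $s\in\mathbb{R}^d$. The geometric median $\mathrm{Gm}(s,\vec\theta)$ is a minimizer over $z\in\mathbb{R}^d$ of $$\mathcal{L}(s,\vec\theta,z)=\frac{1}{1+V}\Big(\|z-s\|_2+\sum_{v=1}^V\|z-\theta_v\|_2\Big).$$ The dimension of $\vec\theta$ is $\dim\vec\theta=\dim\mathrm{span}\{\theta_v-\theta_w: v,w\in\{1,\dots,V\}\}$; when $\dim\vec\theta\ge 2$ the minimizer is unique, so $\mathrm{Gm}(s,\vec\theta)$ is well defined for all $s$. A voting rule $\mathrm{Vote}$ is $\alpha$-strategyproof if for all $\vec\theta$, all $t$ and all $s$: $\|\mathrm{Vote}(t,\vec\theta)-t\|_2\le(1+\alpha)\|\mathrm{Vote}(s,\vec\theta)-t\|_2$.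 *)

theory Defs
  imports "Jordan_Normal_Form.DL_Rank" "HOL-Analysis.L2_Norm"
begin

text \<open>
  The dimension of the ambient space is existentially quantified in the statement, so the elements
  of \<open>\<real>\<^sup>d\<close> are the real vectors in \<^term>\<open>carrier_vec d\<close>. A family of \<open>V\<close> vectors is a function on
  the naturals of which only the values on \<open>{1..V}\<close> are used.
\<close>

definition eucl_norm :: "real Matrix.vec \<Rightarrow> real" where
  "eucl_norm x = L2_set (\<lambda>i. vec_index x i) {..<dim_vec x}"

definition family_differences ::
  "nat \<Rightarrow> (nat \<Rightarrow> real Matrix.vec) \<Rightarrow> real Matrix.vec set" where
  "family_differences V \<theta> = {\<theta> v - \<theta> w | v w. v \<in> {1..V} \<and> w \<in> {1..V}}"

definition family_dim :: "nat \<Rightarrow> nat \<Rightarrow> (nat \<Rightarrow> real Matrix.vec) \<Rightarrow> nat" where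
  "family_dim d V \<theta> =
     (let M = module_vec TYPE(real) d;
          W = LinearCombinations.module.span class_ring M (family_differences V \<theta>)
      in vectorspace.dim class_ring (M\<lparr>carrier := W\<rparr>))"

definition gm_loss ::
  "nat \<Rightarrow> real Matrix.vec \<Rightarrow> (nat \<Rightarrow> real Matrix.vec) \<Rightarrow> real Matrix.vec \<Rightarrow> real" where
  "gm_loss V s \<theta> z =
     1 / (1 + real V) * (eucl_norm (z - s) + (\<Sum>v=1..V. eucl_norm (z - \<theta> v)))"

text \<open>
  The choice made by \<^const>\<open>arg_min\<close> matters only for families of dimension at most one;
  in higher dimension the minimizer is unique.
\<close>

definition geometric_median ::
  "nat \<Rightarrow> nat \<Rightarrow> real Matrix.vec \<Rightarrow> (nat \<Rightarrow> real Matrix.vec) \<Rightarrow> real Matrix.vec" where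
  "geometric_median d V s \<theta> = arg_min (gm_loss V s \<theta>) (\<lambda>z. z \<in> carrier_vec d)"

end

theory Submission
  imports Defs "HOL-Analysis.Line_Segment"
begin

text \<open>
  The four vertices of a rectangle have the intersection of the diagonals as geometric median.
  In a rectangle of width \<open>N\<close> and height \<open>1\<close>, let the target be one vertex and the other voters
  the remaining three. A truthful vote yields the centre, at distance more than \<open>N / 2\<close> from the
  target. If voter \<open>0\<close> instead reports the vertex adjacent to the target along the short side, that
  vertex carries two of the four votes and becomes the geometric median, at distance \<open>1\<close>.
  In both cases, the four votes are paired into two segments that meet in exactly one point, which
  by the triangle inequality is the unique minimizer.
\<close>

text \<open>Complex numbers serve as the plane: unlike carrier vectors they form a Euclidean space
  type, with \<open>dist\<close>, segments and betweenness.\<close>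

definition vec_of_complex :: "complex \<Rightarrow> real Matrix.vec" where
  "vec_of_complex z = Matrix.vec 2 (\<lambda>i. if i = 0 then Re z else Im z)"

lemma vec_of_complex_carrier [simp]: "vec_of_complex z \<in> carrier_vec 2"
  by (simp add: vec_of_complex_def)

lemma vec_of_complex_diff: "vec_of_complex z - vec_of_complex w = vec_of_complex (z - w)"
  by (auto simp: vec_of_complex_def)

lemma vec_of_complex_cases:
  assumes "x \<in> carrier_vec 2"
  obtains z where "x = vec_of_complex z"
proof
  show "x = vec_of_complex (Complex (vec_index x 0) (vec_index x 1))"
    using assms by (intro eq_vecI) (auto simp: vec_of_complex_def less_2_cases_iff)
qed

lemma eucl_norm_vec_of_complex [simp]: "eucl_norm (vec_of_complex z) = cmod z"
  by (simp add: eucl_norm_def vec_of_complex_def L2_set_def cmod_def numeral_2_eq_2)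

text \<open>Strict minimality leaves \<open>arg_min\<close> no choice other than
  \<open>p\<close>.\<close>

lemma geometric_median_eqI:
  assumes "p \<in> carrier_vec d"
    and "\<And>z. z \<in> carrier_vec d \<Longrightarrow> z \<noteq> p \<Longrightarrow> gm_loss V s \<theta> p < gm_loss V s \<theta> z"
  shows "geometric_median d V s \<theta> = p"
  unfolding geometric_median_def
  by (rule arg_minI) (use assms in \<open>force simp: not_less\<close>)+

lemma geometric_median_crossing_segments:
  assumes "closed_segment s (f 2) \<inter> closed_segment (f 1) (f 3) = {p}"
  shows "geometric_median 2 3 (vec_of_complex s) (\<lambda>v. vec_of_complex (f v)) = vec_of_complex p"
proof (rule geometric_median_eqI)
  define pair_loss where "pair_loss a b z = dist a z + dist z b" for a b z :: complex
  have loss: "gm_loss 3 (vec_of_complex s) (\<lambda>v. vec_of_complex (f v)) (vec_of_complex z) =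
      (pair_loss s (f 2) z + pair_loss (f 1) (f 3) z) / 4" for z
    by (simp add: gm_loss_def vec_of_complex_diff pair_loss_def dist_norm norm_minus_commute
        numeral_3_eq_3 numeral_2_eq_2)
  have ge: "dist a b \<le> pair_loss a b z" for a b z
    by (simp add: pair_loss_def dist_triangle)
  have eq: "pair_loss a b z = dist a b \<longleftrightarrow> z \<in> closed_segment a b" for a b z
    by (metis pair_loss_def between between_mem_segment)
  fix x
  assume "x \<in> carrier_vec 2" and ne: "x \<noteq> vec_of_complex p"
  then obtain z where x: "x = vec_of_complex z"
    by (blast elim: vec_of_complex_cases)
  with ne have "z \<notin> closed_segment s (f 2) \<inter> closed_segment (f 1) (f 3)"
    using assms by auto
  \<comment> \<open>A point off the intersection misses one of the two segments, so at least one of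
    the two triangle inequalities is strict.\<close>
  then have "dist s (f 2) + dist (f 1) (f 3) < pair_loss s (f 2) z + pair_loss (f 1) (f 3) z"
    using ge[of s "f 2" z] ge[of "f 1" "f 3" z] eq[of s "f 2" z] eq[of "f 1" "f 3" z] by auto
  moreover have "pair_loss s (f 2) p = dist s (f 2)" "pair_loss (f 1) (f 3) p = dist (f 1) (f 3)"
    using assms eq by auto
  ultimately show "gm_loss 3 (vec_of_complex s) (\<lambda>v. vec_of_complex (f v)) (vec_of_complex p)
      < gm_loss 3 (vec_of_complex s) (\<lambda>v. vec_of_complex (f v)) x"
    by (simp add: x loss)
qed simp

text \<open>Once the span is the whole space, replacing the carrier by it changes nothing, so the
  dimension is that of the ambient space.\<close>

lemma family_dim_eq_ambient:
  assumes "\<And>v. v \<in> {1..V} \<Longrightarrow> \<theta> v \<in> carrier_vec d"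
    and "carrier_vec d \<subseteq>
      LinearCombinations.module.span class_ring (module_vec TYPE(real) d) (family_differences V \<theta>)"
  shows "family_dim d V \<theta> = d"
proof -
  interpret vec_space "TYPE(real)" d .
  have "family_differences V \<theta> \<subseteq> carrier_vec d"
    using assms(1) by (auto simp: family_differences_def)
  then have "span (family_differences V \<theta>) = carrier_vec d"
    using assms(2) span_is_subset2 by auto
  moreover have "module_vec TYPE(real) d\<lparr>carrier := carrier_vec d\<rparr> = module_vec TYPE(real) d"
    by (simp add: module_vec_def)
  ultimately show ?thesis
    using dim_is_n by (simp only: family_dim_def Let_def)
qed

theorem theorem1:
  fixes \<alpha> :: real
  assumes "\<alpha> \<ge> 0"
  shows "\<exists>(d :: nat) (V :: nat) (\<theta> :: nat \<Rightarrow> real Matrix.vec) (t :: real Matrix.vec) (s :: real Matrix.vec).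
           V \<ge> 1 \<and> (\<forall>v\<in>{1..V}. \<theta> v \<in> carrier_vec d) \<and> family_dim d V \<theta> \<ge> 2 \<and>
           t \<in> carrier_vec d \<and> s \<in> carrier_vec d \<and>
           eucl_norm (geometric_median d V t \<theta> - t) >
             (1 + \<alpha>) * eucl_norm (geometric_median d V s \<theta> - t)"
proof -
  \<comment> \<open>Half the width is then 1 + \<alpha>, the factor to be beaten.\<close>
  define N where "N = 2 * (1 + \<alpha>)"
  \<comment> \<open>The order makes \<open>f 2\<close> the vertex opposite the target, so
    \<open>f 1\<close> and \<open>f 3\<close> span the other diagonal.\<close>
  define f where "f v = (if v = 1 then 0 else if v = 2 then Complex N 0 else Complex N 1)"
    for v :: nat
  define \<theta> where "\<theta> v = vec_of_complex (f v)" for v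
  define t where "t = Complex 0 1"
  have N: "N > 0"
    using assms by (simp add: N_def)
  have "closed_segment t (f 2) \<inter> closed_segment (f 1) (f 3) = {Complex (N / 2) (1 / 2)}"
  proof (intro equalityI subsetI)
    fix z assume "z \<in> closed_segment t (f 2) \<inter> closed_segment (f 1) (f 3)"
    then obtain u v where "z = (1 - u) *\<^sub>R t + u *\<^sub>R f 2" "z = (1 - v) *\<^sub>R f 1 + v *\<^sub>R f 3"
      unfolding closed_segment_def by blast
    \<comment> \<open>Real parts give the first equation, as \<open>N\<close> is nonzero, and
      imaginary parts the second; hence both parameters are 1/2.\<close>
    then have "v = u" "v = 1 - u" "z = Complex (v * N) v"
      using N by (auto simp: complex_eq_iff f_def t_def)
    then show "z \<in> {Complex (N / 2) (1 / 2)}"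
      by (auto simp: complex_eq_iff)
  next
    fix z assume "z \<in> {Complex (N / 2) (1 / 2)}"
    then show "z \<in> closed_segment t (f 2) \<inter> closed_segment (f 1) (f 3)"
      by (auto simp: closed_segment_def f_def t_def complex_eq_iff intro!: exI[of _ "1/2"])
  qed
  then have gm_t: "geometric_median 2 3 (vec_of_complex t) \<theta> = vec_of_complex (Complex (N/2) (1/2))"
    unfolding \<theta>_def by (rule geometric_median_crossing_segments)
  \<comment> \<open>The report 0 coincides with \<open>f 1\<close>: a side and a diagonal meet only
    in their common endpoint.\<close>
  have "closed_segment 0 (f 2) \<inter> closed_segment (f 1) (f 3) = {0}"
    using N by (auto simp: closed_segment_def f_def complex_eq_iff)
  then have gm_0: "geometric_median 2 3 (vec_of_complex 0) \<theta> = vec_of_complex 0"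
    unfolding \<theta>_def by (rule geometric_median_crossing_segments)
  interpret vec_space "TYPE(real)" 2 .
  have dim: "family_dim 2 3 \<theta> = 2"
  proof (rule family_dim_eq_ambient)
    let ?D = "family_differences 3 \<theta>"
    let ?e = "vec_of_complex (Complex N 0)" and ?e' = "vec_of_complex (Complex 0 1)"
    have D: "?D \<subseteq> carrier_vec 2"
      by (auto simp: family_differences_def \<theta>_def)
    \<comment> \<open>The sides of the rectangle are scaled basis vectors.\<close>
    have "?e = \<theta> 2 - \<theta> 1" "?e' = \<theta> 3 - \<theta> 2"
      by (simp_all add: \<theta>_def f_def vec_of_complex_diff complex_diff)
    then have "?e \<in> ?D" "?e' \<in> ?D"
      unfolding family_differences_def by fastforce+
    then have e: "?e \<in> span ?D" "?e' \<in> span ?D"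
      using in_own_span[OF D] by auto
    show "carrier_vec 2 \<subseteq> span ?D"
    proof
      fix x :: "real Matrix.vec"
      assume "x \<in> carrier_vec 2"
      then obtain z where "x = vec_of_complex z"
        by (rule vec_of_complex_cases)
      then have "x = (Re z / N) \<cdot>\<^sub>v ?e + Im z \<cdot>\<^sub>v ?e'"
        using N by (auto simp: vec_of_complex_def)
      with e show "x \<in> span ?D"
        using D by (simp add: span_add1 smult_in_span)
    qed
  qed (simp add: \<theta>_def)
  have "(1 + \<alpha>) * cmod (0 - t) = \<bar>Re (Complex (N/2) (1/2) - t)\<bar>"
    using assms by (simp add: t_def N_def cmod_def)
  \<comment> \<open>Strictness comes from the vertical offset of 1/2.\<close>
  also have "\<dots> < cmod (Complex (N/2) (1/2) - t)"
    unfolding cmod_def by (rule real_less_rsqrt) (simp add: t_def power_divide)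
  finally have "(1 + \<alpha>) * eucl_norm (vec_of_complex 0 - vec_of_complex t) <
      eucl_norm (vec_of_complex (Complex (N/2) (1/2)) - vec_of_complex t)"
    by (simp add: vec_of_complex_diff)
  then have "(1 + \<alpha>) * eucl_norm (geometric_median 2 3 (vec_of_complex 0) \<theta> - vec_of_complex t) <
      eucl_norm (geometric_median 2 3 (vec_of_complex t) \<theta> - vec_of_complex t)"
    by (simp only: gm_t gm_0)
  moreover have "\<forall>v\<in>{1..3}. \<theta> v \<in> carrier_vec 2"
    by (simp add: \<theta>_def)
  ultimately show ?thesis
    using dim
    by (intro exI[of _ 2] exI[of _ 3] exI[of _ \<theta>] exI[of _ "vec_of_complex t"]
        exI[of _ "vec_of_complex 0"] conjI) simp_all
qed

end
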